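(* Let $m\ge 1$ be an integer and let $J\subseteq\{0,1,\ldots,m-1\}$ be nonempty. If $C_m(J)$ does not divide $|J|$, then $H_{J,K}$ is not a Hadamard submatrix of $\mathcal{F}_m$ for any $K\subseteq\{0,1,\ldots,m-1\}$ with $|K|=|J|$.
   Context: $\mathcal{F}_m=(e^{2\pi i jk/m})_{0\le j,k\le m-1}$ is the $m\times m$ Fourier matrix. For $J,K\subseteq\{0,\ldots,m-1\}$ with $|J|=|K|=n$, $H_{J,K}=H_{J,K,m}=(e^{2\pi i jk/m})_{j\in J,k\in K}$ is the $n\times n$ submatrix of $\mathcal{F}_m$ with rows $J$ and columns $K$ (each listed in increasing order). An $n\times n$ complex matrix $H$ is Hadamard if all its entries have modulus $1$ and $H^*H=HH^*=nI_n$. For a nonempty finite set $X$ of nonnegative integers, $\mathcal{D}(X)=\{x_1-x_2:x_1,x_2\in X\}$, $\mathcal{P}_m(X)=\left\{\frac{m}{\gcd(m,d)}:d\in\mathcal{D}(X)\right\}$ (with $\gcd(m,0)=m$), and $C_m(X)=\prod_{s\in\mathcal{P}_m(X)\setminus\{1\}}\Phi_s(1)$, where $\Phi_s(z)$ is the $s$-th cyclotomic polynomial. *)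

theory Defs
  imports
    "HOL-Computational_Algebra.Computational_Algebra"
    "Jordan_Normal_Form.DL_Submatrix"
    "Jordan_Normal_Form.Schur_Decomposition"
begin

section \<open>Cyclotomic polynomials\<close>

definition primitive_roots :: "nat \<Rightarrow> complex set" where
  "primitive_roots s = {z. z ^ s = 1 \<and> (\<forall>k\<in>{1..<s}. z ^ k \<noteq> 1)}"

definition cyclotomic_complex :: "nat \<Rightarrow> complex poly" where
  "cyclotomic_complex s = (\<Prod>z\<in>primitive_roots s. [:-z, 1:])"

text \<open>
  The product over the primitive roots of unity has integer coefficients. The following
  integer polynomial is that product; existence and uniqueness are shown in
  \<open>of_int_cyclotomic\<close> and \<open>cyclotomic_unique\<close> below, for positive index. Having
  integer coefficients makes divisibility by the values of the polynomial at 1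
  divisibility in the integers.
\<close>

definition cyclotomic :: "nat \<Rightarrow> int poly" where
  "cyclotomic s = (THE p. map_poly of_int p = cyclotomic_complex s)"

lemma cyclotomic_unique:
  fixes p q :: "int poly"
  assumes "map_poly (of_int :: int \<Rightarrow> complex) p = map_poly of_int q"
  shows "p = q"
proof (rule poly_eqI)
  fix n
  have "Polynomial.coeff (map_poly (of_int :: int \<Rightarrow> complex) p) n
      = Polynomial.coeff (map_poly of_int q) n"
    using assms by simp
  then show "Polynomial.coeff p n = Polynomial.coeff q n"
    by (simp add: coeff_map_poly)
qed

lemma integral_cofactor:
  fixes p r :: "complex poly"
  assumes p: "\<And>i. Polynomial.coeff p i \<in> \<int>" and monic: "lead_coeff p = 1"
    and pr: "\<And>i. Polynomial.coeff (p * r) i \<in> \<int>"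
  shows "Polynomial.coeff r i \<in> \<int>"
  using pr
proof (induction "Polynomial.degree r" arbitrary: r i rule: less_induct)
  case less
  have "lead_coeff (p * r) = lead_coeff r"
    using monic by (simp add: lead_coeff_mult)
  then have lc: "lead_coeff r \<in> \<int>"
    using less.prems by metis
  show ?case
  proof (cases "Polynomial.degree r = 0")
    case True
    then show ?thesis
      using lc coeff_eq_0[of r i] by (cases "i = 0") simp_all
  next
    case False
    define h where "h = Polynomial.monom (lead_coeff r) (Polynomial.degree r)"
    have ph: "Polynomial.coeff (p * h) j \<in> \<int>" for j
      unfolding h_def using p lc
      by (auto simp: coeff_mult intro!: Ints_sum Ints_mult)
    have "Polynomial.degree (r - h) < Polynomial.degree r"
    proof (rule degree_lessI)
      show "r - h \<noteq> 0 \<or> 0 < Polynomial.degree r"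
        using False by simp
      show "\<forall>k\<ge>Polynomial.degree r. Polynomial.coeff (r - h) k = 0"
        by (auto simp: h_def coeff_eq_0)
    qed
    moreover have "Polynomial.coeff (p * (r - h)) j \<in> \<int>" for j
      using less.prems ph by (simp add: algebra_simps)
    ultimately have "Polynomial.coeff (r - h) i \<in> \<int>"
      using less.hyps by blast
    moreover have "Polynomial.coeff h i \<in> \<int>"
      unfolding h_def Polynomial.coeff_monom by (rule if_split[THEN iffD2]) (intro conjI impI lc Ints_0)
    ultimately show ?thesis
      using Ints_add by fastforce
  qed
qed

lemma finite_primitive_roots: "s > 0 \<Longrightarrow> finite (primitive_roots s)"
  by (rule finite_subset[of _ "{z. z ^ s = 1}"])
     (auto simp: primitive_roots_def intro!: finite_roots_unity)

lemma power_mod_order: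
  fixes z :: complex
  assumes "z ^ d = 1"
  shows "z ^ n = z ^ (n mod d)"
proof -
  have "z ^ n = z ^ (d * (n div d) + n mod d)"
    by simp
  also have "\<dots> = z ^ (n mod d)"
    unfolding power_add power_mult using assms by simp
  finally show ?thesis .
qed

lemma primitive_roots_unique:
  assumes "z \<in> primitive_roots a" "z \<in> primitive_roots b" "a > 0" "b > 0"
  shows "a = b"
proof (rule linorder_cases[of a b])
  assume "a < b"
  with assms show ?thesis
    unfolding primitive_roots_def by auto
next
  assume "b < a"
  with assms show ?thesis
    unfolding primitive_roots_def by auto
qed

lemma roots_of_unity_partition:
  assumes n: "n > 0"
  shows "{z :: complex. z ^ n = 1} = (\<Union>d\<in>{d. d dvd n}. primitive_roots d)"
proof safe
  fix z :: complex
  assume z: "z ^ n = 1"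
  define d where "d = (LEAST d. d > 0 \<and> z ^ d = 1)"
  have d: "d > 0 \<and> z ^ d = 1"
    unfolding d_def by (rule LeastI[of _ n]) (use n z in simp)
  have least: "z ^ k \<noteq> 1" if "0 < k" "k < d" for k
    using not_less_Least[of k "\<lambda>d. d > 0 \<and> z ^ d = 1"] that unfolding d_def by auto
  have "z ^ (n mod d) = 1"
    using power_mod_order[of z d n] d z by simp
  then have "n mod d = 0"
    using least[of "n mod d"] d by (cases "n mod d = 0") auto
  then have "d dvd n"
    by auto
  moreover have "z \<in> primitive_roots d"
    using d least by (auto simp: primitive_roots_def)
  ultimately show "z \<in> (\<Union>d\<in>{d. d dvd n}. primitive_roots d)"
    by blast
next
  fix z :: complex and d
  assume "d dvd n" "z \<in> primitive_roots d"
  then show "z ^ n = 1"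
    by (auto simp: primitive_roots_def power_mult elim!: dvdE)
qed

lemma prod_roots_of_unity:
  assumes n: "n > 0"
  shows "(\<Prod>z\<in>{z :: complex. z ^ n = 1}. [:-z, 1:]) = Polynomial.monom 1 n - 1"
proof -
  let ?p = "Polynomial.monom 1 n - 1 :: complex poly"
  have deg: "Polynomial.degree ?p = n"
    using n by (intro antisym degree_le le_degree) (auto simp: coeff_eq_0)
  have lc: "lead_coeff ?p = 1"
    unfolding deg using n by (simp add: coeff_eq_0)
  have "rsquarefree ?p"
    unfolding rsquarefree_roots using n
    by (auto simp: pderiv_diff pderiv_monom poly_monom power_0_left)
  from complex_poly_decompose_rsquarefree[OF this]
  have "(\<Prod>z | poly ?p z = 0. [:-z, 1:]) = ?p"
    unfolding lc by simp
  then show ?thesis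
    by (simp add: poly_monom)
qed

lemma prod_cyclotomic_complex:
  assumes n: "n > 0"
  shows "(\<Prod>d | d dvd n. cyclotomic_complex d) = Polynomial.monom 1 n - 1"
proof -
  have pos: "d > 0" if "d dvd n" for d
    using that n by (auto intro: Nat.gr0I)
  have "(\<Prod>z\<in>(\<Union>d\<in>{d. d dvd n}. primitive_roots d). [:-z, 1:])
      = (\<Prod>d | d dvd n. cyclotomic_complex d)"
    unfolding cyclotomic_complex_def
  proof (rule prod.UNION_disjoint)
    show "finite {d. d dvd n}"
      using n by simp
    show "\<forall>i\<in>{d. d dvd n}. finite (primitive_roots i)"
      using pos finite_primitive_roots by simp
    show "\<forall>i\<in>{d. d dvd n}. \<forall>j\<in>{d. d dvd n}. i \<noteq> j \<longrightarrow> primitive_roots i \<inter> primitive_roots j = {}"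
      using pos primitive_roots_unique by blast
  qed
  then show ?thesis
    using prod_roots_of_unity[OF n] roots_of_unity_partition[OF n] by simp
qed

lemma lead_coeff_cyclotomic_complex: "lead_coeff (cyclotomic_complex s) = 1"
  unfolding cyclotomic_complex_def by (simp add: lead_coeff_prod)

lemma integral_cyclotomic_complex:
  assumes "n > 0"
  shows "Polynomial.coeff (cyclotomic_complex n) i \<in> \<int>"
  using assms
proof (induction n arbitrary: i rule: less_induct)
  case (less n)
  define P where "P = (\<Prod>d\<in>{d. d dvd n} - {n}. cyclotomic_complex d)"
  have small: "0 < d \<and> d < n" if "d \<in> {d. d dvd n} - {n}" for d
    using that less.prems by (auto intro: Nat.gr0I dest: dvd_imp_le)
  have fin: "finite ({d. d dvd n} - {n})"
    using less.prems by simp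
  have int_prod: "Polynomial.coeff (\<Prod>d\<in>A. cyclotomic_complex d) j \<in> \<int>"
    if "finite A" "A \<subseteq> {d. d dvd n} - {n}" for A j
    using that
  proof (induction A arbitrary: j rule: finite_induct)
    case empty
    then show ?case by simp
  next
    case (insert a A)
    then have "Polynomial.coeff (cyclotomic_complex a) k \<in> \<int>" for k
      using less.IH small by blast
    then show ?case
      using insert by (auto simp: coeff_mult intro!: Ints_sum Ints_mult)
  qed
  have "P * cyclotomic_complex n = Polynomial.monom 1 n - 1"
    unfolding P_def using prod_cyclotomic_complex[OF less.prems] less.prems
    by (subst (asm) prod.remove[of _ n]) (simp_all add: mult.commute)
  then have "Polynomial.coeff (P * cyclotomic_complex n) j \<in> \<int>" for j
    by simp
  moreover have "lead_coeff P = 1"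
    unfolding P_def by (simp add: lead_coeff_prod lead_coeff_cyclotomic_complex)
  ultimately show ?case
    using integral_cofactor[of P "cyclotomic_complex n"] int_prod[OF fin] unfolding P_def
    by blast
qed

lemma of_int_cyclotomic:
  assumes "s > 0"
  shows "map_poly of_int (cyclotomic s) = cyclotomic_complex s"
proof -
  obtain p where p: "cyclotomic_complex s = map_poly of_int p"
    using intpolyE integral_cyclotomic_complex[OF assms] by blast
  show ?thesis
    unfolding cyclotomic_def by (rule theI[of _ p]) (use p cyclotomic_unique in auto)
qed


section \<open>The sets and the constant attached to a set of exponents\<close>

definition diff_set :: "nat set \<Rightarrow> int set" where
  "diff_set X = {int x1 - int x2 | x1 x2. x1 \<in> X \<and> x2 \<in> X}"

definition period_set :: "nat \<Rightarrow> nat set \<Rightarrow> nat set" where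
  "period_set m X = {m div nat (gcd (int m) d) | d. d \<in> diff_set X}"

definition cyc_const :: "nat \<Rightarrow> nat set \<Rightarrow> int" where
  "cyc_const m X = (\<Prod>s\<in>period_set m X - {1}. poly (cyclotomic s) 1)"


section \<open>Fourier and Hadamard matrices\<close>

definition fourier_mat :: "nat \<Rightarrow> complex mat" where
  "fourier_mat m = mat m m (\<lambda>(j, k). exp (2 * of_real pi * \<i> * of_nat j * of_nat k / of_nat m))"

text \<open>Rows and columns are selected in increasing order by \<^const>\<open>submatrix\<close>.\<close>

definition fourier_submat :: "nat \<Rightarrow> nat set \<Rightarrow> nat set \<Rightarrow> complex mat" where
  "fourier_submat m J K = submatrix (fourier_mat m) J K"

definition hadamard_mat :: "nat \<Rightarrow> complex mat \<Rightarrow> bool" where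
  "hadamard_mat n H \<longleftrightarrow>
     H \<in> carrier_mat n n \<and>
     (\<forall>i<n. \<forall>j<n. cmod (H $$ (i, j)) = 1) \<and>
     mat_adjoint H * H = of_nat n \<cdot>\<^sub>m 1\<^sub>m n \<and>
     H * mat_adjoint H = of_nat n \<cdot>\<^sub>m 1\<^sub>m n"

lemma fourier_submat_carrier:
  assumes "J \<subseteq> {0..<m}" "K \<subseteq> {0..<m}"
  shows "fourier_submat m J K \<in> carrier_mat (card J) (card K)"
proof -
  have "{i. i < m \<and> i \<in> J} = J" "{i. i < m \<and> i \<in> K} = K"
    using assms by auto
  then show ?thesis
    by (simp add: fourier_submat_def submatrix_def fourier_mat_def)
qed

end

theory Submission
  imports Defs
begin

text \<open>
  Suppose that the submatrix with rows \<open>J\<close> and columns \<open>K\<close> is Hadamard. Its rows \<open>x\<close> and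
  \<open>y\<close> are orthogonal, which says that the exponent polynomial $F(X) = \sum_{k \in K} X^k$
  vanishes at $e^{2\pi i(x-y)/m}$, a root of unity of exact order $m/\gcd(m,x-y)$. As \<open>x\<close> and
  \<open>y\<close> range over distinct elements of \<open>J\<close>, these orders run through all members of
  \<^term>\<open>period_set m J - {1}\<close>, so \<open>F\<close> has at least one primitive \<open>s\<close>-th root of unity as a
  zero for every such \<open>s\<close>. Cyclotomic polynomials are irreducible over the rationals, and
  those of different index share no root. Hence their product over these \<open>s\<close> divides \<open>F\<close> in
  $\mathbb{Z}[X]$, and evaluation at 1 makes \<^term>\<open>cyc_const m J\<close> a divisor of
  $F(1) = |K| = |J|$.

  The irreducibility enters only in the form \<open>root_power_coprime\<close>: an integer polynomial that
  vanishes at \<open>z\<close>, where $z^s = 1$, vanishes at $z^a$ for all positive \<open>a\<close> coprime to \<open>s\<close>. By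
  factoring \<open>a\<close> it is enough to treat a prime \<open>p\<close> not dividing \<open>s\<close>
  (\<open>root_power_prime\<close>), and there Dedekind's argument applies. Let \<open>g\<close> be the minimal
  polynomial of \<open>z\<close> and $X^s - 1 = g h$. If $g(z^p) \ne 0$, then $h(z^p) = 0$, so \<open>g\<close>
  divides $h(X^p)$, which is $h^p$ modulo \<open>p\<close>. This gives \<open>g\<close> and \<open>h\<close> a common factor modulo
  \<open>p\<close>, although $X^s - 1$ is separable modulo \<open>p\<close>. All of this is carried out in
  $\mathbb{Z}[X]$: separability is expressed by an explicit combination of \<open>g\<close> and \<open>h\<close> that
  equals the constant \<open>s\<close>, and the contradiction is that \<open>g\<close>, whose leading coefficient is a
  unit, would divide a nonzero constant modulo \<open>p\<close>
  (\<open>unit_lead_not_dvd_const_mod\<close>).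

  Once all primitive \<open>s\<close>-th roots are known to be zeros of \<open>F\<close>, divisibility of \<open>F\<close> by the
  product of the corresponding linear factors holds over the complex numbers, and the cofactor
  has integer coefficients because the product is monic (\<open>prod_cyclotomic_dvd\<close>).
\<close>

section \<open>The Frobenius map on integer polynomials\<close>

lemma freshmans_dream_dvd:
  fixes a b :: "'a :: comm_ring_1"
  assumes p: "prime p"
  shows "of_nat p dvd (a + b) ^ p - (a ^ p + b ^ p)"
proof -
  let ?t = "\<lambda>k. of_nat (p choose k) * a ^ k * b ^ (p - k)"
  have split: "{..p} = insert 0 (insert p {1..<p})"
    by auto
  have "(a + b) ^ p - (a ^ p + b ^ p) = (\<Sum>k\<in>{1..<p}. ?t k)"
    unfolding binomial_ring split using prime_gt_0_nat[OF p] by simp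
  also have "of_nat p dvd \<dots>"
  proof (rule dvd_sum)
    fix k assume "k \<in> {1..<p}"
    then have "p dvd p choose k"
      using p by (intro dvd_choose_prime) auto
    then obtain c where "p choose k = p * c" ..
    then show "of_nat p dvd ?t k"
      by (simp add: mult.assoc)
  qed
  finally show ?thesis .
qed

text \<open>
  By the previous lemma $x^p - x$ is unchanged modulo \<open>p\<close> when \<open>x\<close> is replaced by $x + 1$, so
  two-sided induction from 0 reaches every integer.
\<close>

lemma fermat_int_dvd:
  assumes p: "prime p"
  shows "int p dvd a ^ p - a"
proof -
  have step: "int p dvd (x + 1) ^ p - (x + 1) \<longleftrightarrow> int p dvd x ^ p - x" for x :: int
  proof -
    have "(x + 1) ^ p - (x + 1) = ((x + 1) ^ p - (x ^ p + 1 ^ p)) + (x ^ p - x)"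
      by simp
    then show ?thesis
      using freshmans_dream_dvd[OF p, of x 1] dvd_add_right_iff by metis
  qed
  show ?thesis
  proof (induction a rule: int_induct[where k = 0])
    case base
    show ?case using prime_gt_0_nat[OF p] by (simp add: power_0_left)
  next
    case (step1 i)
    then show ?case using step by blast
  next
    case (step2 i)
    then show ?case using step[of "i - 1"] by simp
  qed
qed

text \<open>
  Modulo \<open>p\<close> the \<open>p\<close>-th power is additive, and it fixes constants by Fermat's little theorem;
  both facts together let it act on the variable alone.
\<close>

lemma frobenius_poly_dvd:
  fixes h :: "int poly"
  assumes p: "prime p"
  shows "of_nat p dvd pcompose h (Polynomial.monom 1 p) - h ^ p"
proof (induction h)
  case 0
  show ?case using prime_gt_0_nat[OF p] by (simp add: power_0_left)
next
  case (pCons a h)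
  let ?X = "Polynomial.monom 1 1 :: int poly" and ?Y = "Polynomial.monom 1 p :: int poly"
  have comp: "pcompose (pCons a h) ?Y = [:a:] + ?Y * pcompose h ?Y"
    by (rule pcompose_pCons)
  have split: "pCons a h = [:a:] + ?X * h"
    by (simp add: monom_altdef)
  have XY: "?X ^ p = ?Y"
    by (simp add: monom_power)
  obtain c where c: "a ^ p - a = int p * c"
    using fermat_int_dvd[OF p] by blast
  have "[:a:] ^ p - [:a:] = of_nat p * [:c:]"
    using c by (simp add: poly_const_pow of_nat_poly)
  then have 1: "of_nat p dvd [:a:] ^ p - [:a:]"
    by (rule dvdI)
  have 2: "of_nat p dvd ([:a:] + ?X * h) ^ p - ([:a:] ^ p + (?X * h) ^ p)"
    by (rule freshmans_dream_dvd[OF p])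
  have "pcompose (pCons a h) ?Y - pCons a h ^ p
      = ?Y * (pcompose h ?Y - h ^ p) - ([:a:] ^ p - [:a:])
        - (([:a:] + ?X * h) ^ p - ([:a:] ^ p + (?X * h) ^ p))"
    unfolding comp unfolding split power_mult_distrib XY by (simp add: algebra_simps)
  also have "of_nat p dvd \<dots>"
    by (rule dvd_diff[OF dvd_diff[OF dvd_mult[OF pCons.IH] 1] 2])
  finally show ?case .
qed

section \<open>Minimal polynomials over the integers\<close>

text \<open>
  Gauss's lemma: contents are multiplicative, so the constant \<open>c\<close> divides the content of the
  cofactor of \<open>g\<close> and can be cancelled there.
\<close>

lemma primitive_dvd_smult_cancel:
  fixes g f :: "int poly"
  assumes "content g = 1" "c \<noteq> 0" "g dvd Polynomial.smult c f"
  shows "g dvd f"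
proof -
  obtain q where q: "Polynomial.smult c f = g * q"
    using assms(3) ..
  then have "content q = content (Polynomial.smult c f)"
    using assms(1) by (simp add: content_mult)
  then have "c dvd content q"
    by simp
  then obtain r where "q = Polynomial.smult c r"
    unfolding const_poly_dvd_iff_dvd_content[symmetric] by (auto elim: dvdE)
  then have "Polynomial.smult c f = Polynomial.smult c (g * r)"
    using q by simp
  then have "Polynomial.smult c (f - g * r) = 0"
    by (simp add: smult_diff_right)
  then show ?thesis
    using assms(2) by simp
qed

text \<open>
  The polynomial is the primitive part of an integer polynomial of least degree that vanishes
  at \<open>z\<close>. Pseudo-division by it leaves remainder 0, by minimality of the degree, and the
  constant factor that pseudo-division introduces is removed by Gauss's lemma.
\<close>

lemma minimal_int_poly_exists:
  fixes z :: complex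
  assumes "F \<noteq> 0" "poly (of_int_poly F) z = 0"
  obtains g where "g \<noteq> 0" "poly (of_int_poly g) z = 0"
    "\<And>f. poly (of_int_poly f) z = 0 \<Longrightarrow> g dvd f"
proof -
  let ?P = "\<lambda>f :: int poly. f \<noteq> 0 \<and> poly (of_int_poly f) z = 0"
  define g0 where "g0 = arg_min Polynomial.degree ?P"
  have g0: "?P g0" and min: "\<And>f. ?P f \<Longrightarrow> Polynomial.degree g0 \<le> Polynomial.degree f"
    using arg_min_nat_lemma[of ?P F Polynomial.degree] assms unfolding g0_def by auto
  define g where "g = primitive_part g0"
  have g0_eq: "g0 = Polynomial.smult (content g0) g"
    unfolding g_def by simp
  have "g \<noteq> 0" and cont: "content g = 1"
    using g0 by (auto simp: g_def)
  have deg: "Polynomial.degree g = Polynomial.degree g0"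
    unfolding g_def by simp
  have "poly (of_int_poly g0) z = of_int (content g0) * poly (of_int_poly g) z"
    by (subst g0_eq) (simp add: map_poly_smult)
  then have root: "poly (of_int_poly g) z = 0"
    using g0 by simp
  moreover have "g dvd f" if f: "poly (of_int_poly f) z = 0" for f
  proof -
    obtain q r where qr: "pseudo_divmod f g = (q, r)"
      by fastforce
    define c where "c = lead_coeff g ^ (Suc (Polynomial.degree f) - Polynomial.degree g)"
    have eq: "Polynomial.smult c f = g * q + r"
      and r: "r = 0 \<or> Polynomial.degree r < Polynomial.degree g"
      using pseudo_divmod[OF \<open>g \<noteq> 0\<close> qr] unfolding c_def by simp_all
    have "poly (of_int_poly (Polynomial.smult c f)) z = 0"
      using f by (simp add: map_poly_smult)
    then have "poly (of_int_poly r) z = 0"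
      unfolding eq using root by (simp add: of_int_poly_hom.hom_add of_int_poly_hom.hom_mult)
    then have "r = 0"
      using r min[of r] deg by fastforce
    then have "g dvd Polynomial.smult c f"
      using eq by simp
    moreover have "c \<noteq> 0"
      using \<open>g \<noteq> 0\<close> by (simp add: c_def)
    ultimately show ?thesis
      using primitive_dvd_smult_cancel cont by blast
  qed
  ultimately show ?thesis
    using that \<open>g \<noteq> 0\<close> by blast
qed

text \<open>
  Reduction modulo \<open>p\<close> preserves the degree of \<open>g\<close>, so \<open>g\<close> cannot divide a nonzero constant
  there. The proof stays over the integers: \<open>X\<close> is replaced by its remainder modulo \<open>g\<close>, which
  leaves a multiple of \<open>g\<close> of smaller degree, hence 0, and its constant term contradicts the
  assumption on \<open>n\<close>.
\<close>

lemma unit_lead_not_dvd_const_mod: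
  fixes g X :: "int poly"
  assumes lead: "is_unit (lead_coeff g)" and deg: "Polynomial.degree g > 0"
    and n: "\<not> int p dvd n"
  shows "\<not> g dvd [:n:] + of_nat p * X"
proof
  assume dvd: "g dvd [:n:] + of_nat p * X"
  have "g \<noteq> 0"
    using deg by auto
  obtain q r where qr: "pseudo_divmod X g = (q, r)"
    by fastforce
  define c where "c = lead_coeff g ^ (Suc (Polynomial.degree X) - Polynomial.degree g)"
  have eq: "Polynomial.smult c X = g * q + r"
    and r: "r = 0 \<or> Polynomial.degree r < Polynomial.degree g"
    using pseudo_divmod[OF \<open>g \<noteq> 0\<close> qr] unfolding c_def by simp_all
  have c: "is_unit c"
    using lead unfolding c_def by (metis dvd_power_same power_one)
  let ?e = "[:c * n:] + of_nat p * r"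
  have "?e = Polynomial.smult c ([:n:] + of_nat p * X) - g * (of_nat p * q)"
  proof -
    have "Polynomial.smult c ([:n:] + of_nat p * X) = [:c * n:] + of_nat p * Polynomial.smult c X"
      by (simp add: smult_add_right)
    then show ?thesis
      unfolding eq by (simp add: algebra_simps)
  qed
  then have "g dvd ?e"
    using dvd by (simp add: dvd_smult)
  moreover have "Polynomial.degree ?e < Polynomial.degree g"
  proof (rule degree_add_less)
    show "Polynomial.degree [:c * n:] < Polynomial.degree g"
      using deg by simp
    show "Polynomial.degree (of_nat p * r) < Polynomial.degree g"
      using r deg by (auto simp: of_nat_poly)
  qed
  ultimately have "?e = 0"
    using dvd_imp_degree_le[of g ?e] by linarith
  then have "Polynomial.coeff ?e 0 = 0"
    by simp
  then have "c * n + int p * Polynomial.coeff r 0 = 0"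
    by (simp add: of_nat_poly)
  then have "c * n = int p * (- Polynomial.coeff r 0)"
    by linarith
  then have "int p dvd c * n"
    by (rule dvdI)
  then show False
    using n c by (metis dvd_mult_unit_iff')
qed

section \<open>Galois conjugates of roots of unity\<close>

text \<open>
  Dedekind's argument for the irreducibility of cyclotomic polynomials, in the form that the
  \<open>p\<close>-th power of \<open>z\<close> is a conjugate of \<open>z\<close>. The condition $z^s = 1$ passes on to $z^p$, so
  the lemma can be iterated over the prime factors of an exponent.
\<close>

lemma root_power_prime:
  fixes F :: "int poly" and z :: complex
  assumes z: "z ^ s = 1" and s: "s > 0" and p: "prime p" and ps: "\<not> p dvd s"
    and F: "poly (of_int_poly F) z = 0"
  shows "poly (of_int_poly F) (z ^ p) = 0"
proof -
  let ?E = "Polynomial.monom 1 s - 1 :: int poly"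
  have "of_int_poly ?E = (Polynomial.monom 1 s - 1 :: complex poly)"
    by (simp add: of_int_poly_hom.hom_minus map_poly_monom)
  then have E: "poly (of_int_poly ?E) w = w ^ s - 1" for w :: complex
    by (simp add: poly_monom)
  have degE: "Polynomial.degree ?E = s"
    using s by (intro antisym degree_le le_degree) (auto simp: coeff_eq_0)
  then have "?E \<noteq> 0"
    using s by auto
  then obtain g where g0: "g \<noteq> 0" and gz: "poly (of_int_poly g) z = 0"
    and gmin: "\<And>f. poly (of_int_poly f) z = 0 \<Longrightarrow> g dvd f"
    using minimal_int_poly_exists[of ?E z] E z by auto
  obtain h where h: "?E = g * h"
    using gmin[of ?E] E z by auto
  have "lead_coeff g * lead_coeff h = lead_coeff ?E"
    unfolding h by (simp add: lead_coeff_mult)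
  also have "\<dots> = 1"
    unfolding degE using s by simp
  finally have unit: "is_unit (lead_coeff g)"
    by (metis dvd_triv_left)
  have degg: "Polynomial.degree g > 0"
  proof (rule ccontr)
    assume "\<not> Polynomial.degree g > 0"
    then obtain a where "g = [:a:]"
      using degree_eq_zeroE by blast
    then show False
      using gz g0 by simp
  qed
  have "poly (of_int_poly g) (z ^ p) = 0"
  proof (rule ccontr)
    assume ne: "poly (of_int_poly g) (z ^ p) \<noteq> 0"
    have "poly (of_int_poly ?E) (z ^ p) = 0"
      unfolding E using z by (metis power_commutes power_mult mult.commute power_one right_minus_eq)
    then have "poly (of_int_poly h) (z ^ p) = 0"
      unfolding h using ne by (simp add: of_int_poly_hom.hom_mult)
    then have "poly (of_int_poly (pcompose h (Polynomial.monom 1 p))) z = 0"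
      by (simp add: of_int_hom.map_poly_pcompose poly_pcompose map_poly_monom poly_monom)
    then have gh: "g dvd pcompose h (Polynomial.monom 1 p)"
      by (rule gmin)
    obtain W where W: "pcompose h (Polynomial.monom 1 p) - h ^ p = of_nat p * W"
      using frobenius_poly_dvd[OF p] by blast
    \<comment> \<open>Differentiating $g h = X^s - 1$ and multiplying by \<open>X\<close> gives
      $X (g h)' = s X^s = s (g h + 1)$, a Bezout identity for the constant \<open>s\<close>.\<close>
    let ?x = "Polynomial.monom 1 1 :: int poly"
    define B where "B = ?x * pderiv g"
    define A where "A = ?x * pderiv h - of_nat s * h"
    have bez: "of_nat s = A * g + B * h"
    proof -
      have "?x * pderiv ?E = of_nat s * (?E + 1)"
        using s by (simp add: pderiv_diff pderiv_monom mult_monom of_nat_poly smult_monom)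
      then show ?thesis
        unfolding h A_def B_def by (simp add: pderiv_mult algebra_simps)
    qed
    \<comment> \<open>Modulo \<open>g\<close> the \<open>p\<close>-th power of this identity involves \<open>h\<close> only through $h^p$, which
      \<open>g\<close> divides up to a multiple of \<open>p\<close>.\<close>
    have "g dvd of_nat s ^ p - (B * h) ^ p"
    proof -
      have "g dvd of_nat s - B * h"
        unfolding bez by simp
      then show ?thesis
        unfolding power_diff_sumr2 by (rule dvd_mult2)
    qed
    moreover have "of_nat s ^ p - (B * h) ^ p
        = of_nat s ^ p + of_nat p * (W * B ^ p) - B ^ p * pcompose h (Polynomial.monom 1 p)"
    proof -
      have "pcompose h (Polynomial.monom 1 p) = h ^ p + of_nat p * W"
        using W by (simp add: algebra_simps)
      then show ?thesis
        by (simp add: algebra_simps power_mult_distrib)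
    qed
    ultimately have "g dvd of_nat s ^ p + of_nat p * (W * B ^ p)"
      using gh by (metis dvd_add_left_iff dvd_mult diff_add_cancel)
    moreover have "(of_nat s ^ p :: int poly) = [:int (s ^ p):]"
      by (simp add: of_nat_poly poly_const_pow)
    moreover have "\<not> int p dvd int (s ^ p)"
      using ps p by (metis of_nat_dvd_iff prime_dvd_power)
    ultimately show False
      using unit_lead_not_dvd_const_mod[OF unit degg] by metis
  qed
  moreover have "g dvd F"
    using gmin F by blast
  ultimately show ?thesis
    by (auto simp: of_int_poly_hom.hom_mult elim!: dvdE)
qed

lemma root_power_coprime:
  fixes F :: "int poly" and z :: complex
  assumes "z ^ s = 1" "s > 0" "coprime a s" "poly (of_int_poly F) z = 0" "a > 0"
  shows "poly (of_int_poly F) (z ^ a) = 0"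
  using assms
proof (induction a arbitrary: z rule: prime_divisors_induct)
  case zero
  then show ?case by simp
next
  case (unit a)
  then show ?case by simp
next
  case (factor p a)
  have "\<not> p dvd s"
    using factor.prems(3) factor.hyps by (metis coprime_mult_left_iff coprime_absorb_left not_prime_unit)
  then have "poly (of_int_poly F) (z ^ p) = 0"
    using root_power_prime factor by blast
  moreover have "(z ^ p) ^ s = 1"
    using factor.prems(1) by (metis power_commutes power_mult mult.commute power_one)
  ultimately have "poly (of_int_poly F) ((z ^ p) ^ a) = 0"
    using factor by (intro factor.IH) auto
  then show ?case
    by (simp add: power_mult)
qed

text \<open>
  The powers of \<open>z\<close> with exponents 1 to \<open>s\<close> are distinct, so by counting they are all the
  \<open>s\<close>-th roots of unity. If the exponent \<open>a\<close> of \<open>w\<close> shared a factor \<open>t\<close> with \<open>s\<close>, the order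
  of \<open>w\<close> would divide $s/t$.
\<close>

lemma primitive_root_power:
  assumes z: "z \<in> primitive_roots s" and w: "w \<in> primitive_roots s" and s: "s > 0"
  obtains a where "w = z ^ a" "coprime a s" "a > 0"
proof -
  have z1: "z ^ s = 1" and w1: "w ^ s = 1"
    and zmin: "\<And>k. 0 < k \<Longrightarrow> k < s \<Longrightarrow> z ^ k \<noteq> 1"
    and wmin: "\<And>k. 0 < k \<Longrightarrow> k < s \<Longrightarrow> w ^ k \<noteq> 1"
    using z w by (simp_all add: primitive_roots_def)
  have z0: "z \<noteq> 0"
    using z1 s by (auto simp: power_0_left)
  have ne: "z ^ i \<noteq> z ^ j" if "i < j" "j \<le> s" "i > 0" for i j
  proof
    assume eq: "z ^ i = z ^ j"
    have "z ^ j = z ^ i * z ^ (j - i)"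
      using that by (simp flip: power_add)
    then have "z ^ (j - i) = 1"
      using eq z0 by simp
    then show False
      using zmin[of "j - i"] that by simp
  qed
  have inj: "inj_on (\<lambda>i. z ^ i) {1..s}"
    by (rule linorder_inj_onI) (use ne in auto)
  have "(\<lambda>i. z ^ i) ` {1..s} = {w. w ^ s = 1}"
  proof (rule card_subset_eq)
    show "finite {w :: complex. w ^ s = 1}"
      using s by (intro finite_roots_unity) simp
    show "(\<lambda>i. z ^ i) ` {1..s} \<subseteq> {w. w ^ s = 1}"
    proof safe
      fix i
      show "(z ^ i) ^ s = 1"
        using z1 by (metis mult.commute power_mult power_one)
    qed
    show "card ((\<lambda>i. z ^ i) ` {1..s}) = card {w :: complex. w ^ s = 1}"
      using card_roots_unity_eq[OF s] card_image[OF inj] by simp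
  qed
  then obtain a where a: "w = z ^ a" "a \<in> {1..s}"
    using w1 by blast
  define t where "t = gcd a s"
  obtain u v where u: "a = t * u" and v: "s = t * v"
    unfolding t_def by (meson dvdE gcd_dvd1 gcd_dvd2)
  have v0: "v > 0"
    using s v by (intro Nat.gr0I) simp
  have "w ^ v = z ^ (s * u)"
    unfolding a(1) u v power_mult[symmetric] by (simp only: ac_simps)
  then have "w ^ v = 1"
    using z1 by (simp add: power_mult)
  then have "\<not> v < s"
    using wmin[OF v0] by blast
  then have "t \<le> 1"
    using v v0 by simp
  moreover have "t > 0"
    using s by (simp add: t_def)
  ultimately have "t = 1"
    by simp
  then have "coprime a s"
    by (simp add: t_def coprime_iff_gcd_eq_1)
  then show ?thesis
    using a that by simp
qed

section \<open>Divisibility by products of cyclotomic polynomials\<close>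

lemma prod_linear_factors_dvd:
  fixes P :: "'a :: idom poly"
  assumes "finite R" "\<And>z. z \<in> R \<Longrightarrow> poly P z = 0"
  shows "(\<Prod>z\<in>R. [:-z, 1:]) dvd P"
  using assms
proof (induction R rule: finite_induct)
  case empty
  then show ?case by simp
next
  case (insert a R)
  then obtain Q where Q: "P = (\<Prod>z\<in>R. [:-z, 1:]) * Q"
    by (auto elim: dvdE)
  have "poly (\<Prod>z\<in>R. [:-z, 1:]) a \<noteq> 0"
    using insert.hyps by (auto simp: poly_prod)
  moreover have "poly P a = 0"
    using insert.prems by blast
  ultimately have "poly Q a = 0"
    by (simp add: Q)
  then have "[:-a, 1:] dvd Q"
    by (simp add: poly_eq_0_iff_dvd)
  then have "[:-a, 1:] * (\<Prod>z\<in>R. [:-z, 1:]) dvd Q * (\<Prod>z\<in>R. [:-z, 1:])"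
    by (rule mult_dvd_mono) simp
  then show ?case
    unfolding prod.insert[OF insert.hyps] Q by (simp only: mult.commute)
qed

text \<open>
  One common zero per index already forces divisibility by the whole product: conjugation
  supplies all primitive roots of each order, and primitive roots of different orders are
  distinct, so the linear factors that occur are pairwise different.
\<close>

lemma prod_cyclotomic_dvd:
  fixes F :: "int poly"
  assumes S: "finite S" "0 \<notin> S"
    and roots: "\<And>s. s \<in> S \<Longrightarrow> \<exists>z\<in>primitive_roots s. poly (of_int_poly F) z = 0"
  shows "(\<Prod>s\<in>S. cyclotomic s) dvd F"
proof -
  let ?C = "\<Prod>s\<in>S. cyclotomic s"
  have pos: "s > 0" if "s \<in> S" for s
    using that S by (metis gr0I)
  define R where "R = (\<Union>s\<in>S. primitive_roots s)"
  have C: "of_int_poly ?C = (\<Prod>s\<in>S. cyclotomic_complex s)"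
    using pos by (simp add: of_int_poly_hom.hom_prod of_int_cyclotomic)
  also have "\<dots> = (\<Prod>z\<in>R. [:-z, 1:])"
    unfolding R_def cyclotomic_complex_def
    by (rule prod.UNION_disjoint[symmetric])
       (use S(1) pos finite_primitive_roots primitive_roots_unique in blast)+
  also have "\<dots> dvd of_int_poly F"
  proof (rule prod_linear_factors_dvd)
    show "finite R"
      unfolding R_def using S(1) pos finite_primitive_roots by blast
    fix w assume "w \<in> R"
    then obtain s where s: "s \<in> S" "w \<in> primitive_roots s"
      unfolding R_def by blast
    obtain z where z: "z \<in> primitive_roots s" "poly (of_int_poly F) z = 0"
      using roots s by blast
    obtain a where a: "w = z ^ a" "coprime a s" "a > 0"
      using primitive_root_power z s pos by blast
    show "poly (of_int_poly F) w = 0"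
      unfolding a(1) using a z pos[OF s(1)]
      by (intro root_power_coprime[of z s]) (auto simp: primitive_roots_def)
  qed
  finally obtain r :: "complex poly" where r: "of_int_poly F = of_int_poly ?C * r" ..
  have "Polynomial.coeff r i \<in> \<int>" for i
  proof (rule integral_cofactor[of "of_int_poly ?C"])
    show "lead_coeff (of_int_poly ?C :: complex poly) = 1"
      unfolding C by (simp add: lead_coeff_prod lead_coeff_cyclotomic_complex)
    show "Polynomial.coeff (of_int_poly ?C * r) i \<in> \<int>" for i
      unfolding r[symmetric] by (simp add: coeff_map_poly)
  qed (simp add: coeff_map_poly)
  then obtain q where "r = of_int_poly q"
    using intpolyE by blast
  then have "F = ?C * q"
    using r by (intro cyclotomic_unique) (simp add: of_int_poly_hom.hom_mult)
  then show ?thesis ..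
qed

section \<open>Hadamard submatrices of the Fourier matrix\<close>

text \<open>
  The \<open>k\<close>-th power of the number is 1 exactly if \<open>m\<close> divides \<open>d * k\<close>; dividing by
  $\gcd(m,d)$ leaves a divisibility in which the factor coming from \<open>d\<close> is coprime to the
  modulus.
\<close>

lemma exp_primitive_root:
  fixes m :: nat and d :: int
  assumes m: "m > 0"
  shows "exp (2 * of_real pi * \<i> * of_int d / of_nat m)
    \<in> primitive_roots (m div nat (gcd (int m) d))"
    (is "?z \<in> primitive_roots ?s")
proof -
  let ?g = "gcd (int m) d"
  have g: "?g > 0" "?g dvd int m" "?g dvd d"
    using m by auto
  have s: "int ?s = int m div ?g"
    using g by (simp add: zdiv_int)
  have pow: "?z ^ k = 1 \<longleftrightarrow> ?s dvd k" for k
  proof -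
    have "?z ^ k = exp (2 * of_real pi * \<i> * of_int d * of_nat k / of_nat m)"
      by (simp add: exp_of_nat_mult[symmetric] mult_ac)
    also have "\<dots> = cis (2 * pi * of_int d * of_nat k / of_nat m)"
      by (simp add: cis_conv_exp mult_ac)
    also have "\<dots> = 1 \<longleftrightarrow> cos (2 * pi * of_int d * of_nat k / of_nat m) = 1"
      by (auto simp: complex_eq_iff cos_one_sin_zero)
    also have "\<dots> \<longleftrightarrow> (\<exists>n. 2 * pi * of_int d * of_nat k / of_nat m = of_int n * 2 * pi)"
      by (rule cos_one_2pi_int)
    also have "\<dots> \<longleftrightarrow> (\<exists>n. d * int k = n * int m)"
    proof (rule ex_cong1)
      fix n :: int
      have "2 * pi * of_int d * of_nat k / of_nat m = of_int n * 2 * pi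
          \<longleftrightarrow> real_of_int d * of_nat k = of_int n * of_nat m"
        using m by (simp add: field_simps)
      also have "\<dots> \<longleftrightarrow> real_of_int (d * int k) = real_of_int (n * int m)"
        by simp
      also have "\<dots> \<longleftrightarrow> d * int k = n * int m"
        by (rule of_int_eq_iff)
      finally show "2 * pi * of_int d * of_nat k / of_nat m = of_int n * 2 * pi
          \<longleftrightarrow> d * int k = n * int m" .
    qed
    also have "\<dots> \<longleftrightarrow> int m dvd d * int k"
      by (metis dvd_def mult.commute)
    also have "\<dots> \<longleftrightarrow> ?g * (int m div ?g) dvd ?g * ((d div ?g) * int k)"
      unfolding mult.assoc[symmetric] using g by simp
    also have "\<dots> \<longleftrightarrow> int m div ?g dvd (d div ?g) * int k"
    proof (rule dvd_times_left_cancel_iff)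
      show "?g \<noteq> 0"
        using g(1) by linarith
    qed
    also have "\<dots> \<longleftrightarrow> int m div ?g dvd int k"
    proof (rule coprime_dvd_mult_right_iff, rule div_gcd_coprime)
      show "int m \<noteq> 0 \<or> d \<noteq> 0"
        using m by simp
    qed
    also have "\<dots> \<longleftrightarrow> ?s dvd k"
      unfolding s[symmetric] by (rule int_dvd_int_iff)
    finally show ?thesis .
  qed
  show ?thesis
    unfolding primitive_roots_def mem_Collect_eq pow using nat_dvd_not_less by auto
qed

lemma index_mat_adjoint:
  assumes "i < dim_col A" "j < dim_row A"
  shows "mat_adjoint A $$ (i, j) = conjugate (A $$ (j, i))"
  using assms unfolding mat_adjoint_def mat_of_rows_def by simp

lemma fourier_submat_index:
  assumes "J \<subseteq> {0..<m}" "K \<subseteq> {0..<m}" "i < card J" "l < card K"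
  shows "fourier_submat m J K $$ (i, l)
    = exp (2 * of_real pi * \<i> * of_nat (pick J i) * of_nat (pick K l) / of_nat m)"
proof -
  have JK: "{i. i < m \<and> i \<in> J} = J" "{i. i < m \<and> i \<in> K} = K"
    using assms by auto
  have "pick J i \<in> J" "pick K l \<in> K"
    using assms pick_in_set_le by blast+
  then have "pick J i < m" "pick K l < m"
    using assms by auto
  then show ?thesis
    using assms JK unfolding fourier_submat_def
    by (subst submatrix_index) (auto simp: fourier_mat_def)
qed

lemma bij_betw_pick:
  assumes "finite K"
  shows "bij_betw (pick K) {0..<card K} K"
proof (rule bij_betw_imageI)
  show inj: "inj_on (pick K) {0..<card K}"
    by (rule linorder_inj_onI) (use pick_mono_le in \<open>auto simp: less_imp_neq\<close>)
  show "pick K ` {0..<card K} = K"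
    using assms by (intro card_subset_eq) (auto simp: pick_in_set_le card_image[OF inj])
qed

text \<open>
  This is the orthogonality of the rows belonging to \<open>x\<close> and \<open>y\<close>: an entry of one row times the
  conjugate of the corresponding entry of the other depends on the rows only through
  \<open>x - y\<close>.
\<close>

lemma hadamard_fourier_vanishing_sum:
  assumes J: "J \<subseteq> {0..<m}" and K: "K \<subseteq> {0..<m}" and card: "card K = card J"
    and H: "hadamard_mat (card J) (fourier_submat m J K)"
    and x: "x \<in> J" "y \<in> J" "x \<noteq> y"
  shows "(\<Sum>k\<in>K. exp (2 * of_real pi * \<i> * of_int (int x - int y) / of_nat m) ^ k) = 0"
proof -
  let ?n = "card J" and ?H = "fourier_submat m J K"
  have finJ: "finite J" and finK: "finite K"
    using J K finite_subset by blast+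
  have "x \<in> pick J ` {0..<?n}" "y \<in> pick J ` {0..<?n}"
    using bij_betw_imp_surj_on[OF bij_betw_pick[OF finJ]] x by simp_all
  then obtain i j where ij: "i < ?n" "j < ?n" "x = pick J i" "y = pick J j"
    by auto
  have dim: "?H \<in> carrier_mat ?n ?n"
    using fourier_submat_carrier[OF J K] card by simp
  then have adj: "mat_adjoint ?H \<in> carrier_mat ?n ?n"
    unfolding mat_adjoint_def by (intro carrier_matI) auto
  have orth: "?H * mat_adjoint ?H = of_nat ?n \<cdot>\<^sub>m 1\<^sub>m ?n"
    using H unfolding hadamard_mat_def by (elim conjE)
  have "i \<noteq> j"
    using ij x by blast
  then have "0 = (?H * mat_adjoint ?H) $$ (i, j)"
    unfolding orth using ij by simp
  also have "\<dots> = (\<Sum>l = 0..<?n. ?H $$ (i, l) * cnj (?H $$ (j, l)))"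
    using dim adj ij by (simp add: scalar_prod_def index_mat_adjoint)
  also have "\<dots> = (\<Sum>l = 0..<?n.
      exp (2 * of_real pi * \<i> * of_int (int x - int y) / of_nat m) ^ pick K l)"
  proof (rule sum.cong[OF refl])
    fix l assume "l \<in> {0..<?n}"
    then have "?H $$ (i, l) * cnj (?H $$ (j, l))
        = exp (2 * of_real pi * \<i> * of_nat x * of_nat (pick K l) / of_nat m)
          * cnj (exp (2 * of_real pi * \<i> * of_nat y * of_nat (pick K l) / of_nat m))"
      using fourier_submat_index[OF J K] ij card by simp
    also have "\<dots> = cis (2 * pi * x * pick K l / m) * cnj (cis (2 * pi * y * pick K l / m))"
      by (simp add: cis_conv_exp mult_ac)
    also have "\<dots> = cis (2 * pi * x * pick K l / m - 2 * pi * y * pick K l / m)"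
      by (simp add: cis_cnj cis_mult)
    also have "\<dots> = cis (pick K l * (2 * pi * of_int (int x - int y) / m))"
      by (rule arg_cong[where f = cis]) (simp add: diff_divide_distrib algebra_simps)
    also have "\<dots> = cis (2 * pi * of_int (int x - int y) / m) ^ pick K l"
      by (simp only: Complex.DeMoivre)
    also have "cis (2 * pi * of_int (int x - int y) / m)
        = exp (2 * of_real pi * \<i> * of_int (int x - int y) / of_nat m)"
      by (simp add: cis_conv_exp mult_ac)
    finally show "?H $$ (i, l) * cnj (?H $$ (j, l))
        = exp (2 * of_real pi * \<i> * of_int (int x - int y) / of_nat m) ^ pick K l" .
  qed
  also have "\<dots> = (\<Sum>k\<in>K. exp (2 * of_real pi * \<i> * of_int (int x - int y) / of_nat m) ^ k)"
    using sum.reindex_bij_betw[OF bij_betw_pick[OF finK],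
      of "\<lambda>k. exp (2 * of_real pi * \<i> * of_int (int x - int y) / of_nat m) ^ k"] card by simp
  finally show ?thesis by simp
qed

theorem theorem2p1:
  fixes m :: nat and J :: "nat set"
  assumes "m \<ge> 1"
    and "J \<subseteq> {0..<m}"
    and "J \<noteq> {}"
    and "\<not> cyc_const m J dvd int (card J)"
  shows "\<forall>K. K \<subseteq> {0..<m} \<and> card K = card J \<longrightarrow>
           \<not> hadamard_mat (card J) (fourier_submat m J K)"
proof (intro allI impI notI, elim conjE)
  fix K
  assume K: "K \<subseteq> {0..<m}" and card: "card K = card J"
    and H: "hadamard_mat (card J) (fourier_submat m J K)"
  let ?S = "period_set m J - {1}"
  \<comment> \<open>the exponent polynomial of \<open>K\<close>, whose value at 1 is the number of columns\<close>
  define F :: "int poly" where "F = (\<Sum>k\<in>K. Polynomial.monom 1 k)"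
  have F: "poly (of_int_poly F) z = (\<Sum>k\<in>K. z ^ k)" for z :: complex
    by (simp add: F_def of_int_poly_hom.hom_sum map_poly_monom poly_sum poly_monom)
  have pos: "0 < m div nat (gcd (int m) d)" for d
  proof -
    have "0 < gcd (int m) d"
      using assms(1) by simp
    moreover have "gcd (int m) d \<le> int m"
      using assms(1) by (intro gcd_le1_int) simp
    ultimately show ?thesis
      by (simp add: div_greater_zero_iff)
  qed
  have "(\<Prod>s\<in>?S. cyclotomic s) dvd F"
  proof (rule prod_cyclotomic_dvd)
    have "finite J"
      using assms(2) finite_subset by blast
    moreover have "period_set m J
        = (\<lambda>(x, y). m div nat (gcd (int m) (int x - int y))) ` (J \<times> J)"
      by (auto simp: period_set_def diff_set_def image_iff)
    ultimately show "finite ?S"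
      by simp
    show "0 \<notin> ?S"
    proof
      assume "0 \<in> ?S"
      then obtain d where "m div nat (gcd (int m) d) = 0"
        unfolding period_set_def by auto
      then show False
        using pos[of d] by simp
    qed
    fix s assume s: "s \<in> ?S"
    then obtain x y where xy: "x \<in> J" "y \<in> J"
      and s_eq: "s = m div nat (gcd (int m) (int x - int y))"
      by (auto simp: period_set_def diff_set_def)
    have "x \<noteq> y"
      using s s_eq assms(1) by auto
    then have "poly (of_int_poly F) (exp (2 * of_real pi * \<i> * of_int (int x - int y) / of_nat m)) = 0"
      unfolding F using hadamard_fourier_vanishing_sum[OF assms(2) K card H xy] by blast
    then show "\<exists>z\<in>primitive_roots s. poly (of_int_poly F) z = 0"
      unfolding s_eq by (rule bexI) (rule exp_primitive_root, use assms(1) in simp)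
  qed
  then obtain q where "F = (\<Prod>s\<in>?S. cyclotomic s) * q" ..
  then have "poly F 1 = cyc_const m J * poly q 1"
    by (simp add: cyc_const_def poly_prod)
  moreover have "poly F 1 = int (card J)"
    by (simp add: F_def poly_sum poly_monom card)
  ultimately show False
    using assms(4) by simp
qed

end
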